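(* Let $\phi,\psi\in\mathcal A$ and $0\le t\le 1$. Let $f_j=h_j+\overline{g_j}\in\mathcal{S}_{\mathcal H}^0$ $(j=1,2)$ with $f_1\in\mathcal{W}_{\mathcal H}^{1}(\phi)$ and $f_2\in\mathcal{W}_{\mathcal H}^{1}(\psi)$, i.e. $h_1+g_1=\phi$ and $h_2+g_2=\psi$, and let $\omega_j=g_j'/h_j'$ be the dilatation of $f_j$. Suppose that $\Re\big((1-\omega_1\overline{\omega_2})h_1'\overline{h_2'}\big)\ge0$ in $\mathbb D$ and that $t\phi+(1-t)\psi$ is convex in the direction of the imaginary axis. Then $f_3=tf_1+(1-t)f_2$ is univalent and convex in the direction of the imaginary axis.
   Context: $\mathbb{D}=\{z\in\mathbb{C}:|z|<1\}$. $\mathcal H$ is the class of complex-valued harmonic functions $f$ in $\mathbb D$ with $f(0)=f_{\bar z}(0)=f_z(0)-1=0$; each is written $f=h+\overline g$ with $h(z)=z+\sum_{n\ge2}a_nz^n$ and $g(z)=\sum_{n\ge2}b_nz^n$ analytic in $\mathbb D$. $\mathcal S_{\mathcal H}^0$ is the subclass of $\mathcal H$ of univalent, sense-preserving functions (a function in $\mathcal H$ is locally univalent and sense-preserving if and only if $|g'|<|h'|$ in $\mathbb D$). $\mathcal A$ is the subclass of $\mathcal H$ of normalized analytic functions. For $\phi\in\mathcal A$ and $|\lambda|=1$, $\mathcal W_{\mathcal H}^\lambda(\phi)=\{h+\overline g\in\mathcal H: h+\lambda g=\phi\}$. A domain is convex in the direction of the imaginary axis if its intersection with each vertical line is connected or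 empty; a function in $\mathcal H$ is convex in the direction of the imaginary axis if it maps $\mathbb D$ onto such a domain.
   Formalization: The formal theorem additionally assumes that tφ+(1−t)ψ is univalent in D; with convexity in the direction of the imaginary axis required only of its image the claim fails, and this univalence is necessary for the conclusion. *)

theory Defs
  imports "HOL-Complex_Analysis.Complex_Analysis"
begin

abbreviation unit_disc :: "complex set" where
  "unit_disc \<equiv> ball 0 1"

definition partial_x :: "(complex \<Rightarrow> complex) \<Rightarrow> complex \<Rightarrow> complex" where
  "partial_x f z = frechet_derivative f (at z) 1"

definition partial_y :: "(complex \<Rightarrow> complex) \<Rightarrow> complex \<Rightarrow> complex" where
  "partial_y f z = frechet_derivative f (at z) \<i>"

definition wirtinger_z :: "(complex \<Rightarrow> complex) \<Rightarrow> complex \<Rightarrow> complex" where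
  "wirtinger_z f z = (partial_x f z - \<i> * partial_y f z) / 2"

definition wirtinger_zbar :: "(complex \<Rightarrow> complex) \<Rightarrow> complex \<Rightarrow> complex" where
  "wirtinger_zbar f z = (partial_x f z + \<i> * partial_y f z) / 2"

text \<open>Twice continuously (real) differentiable with vanishing Laplacian; meant for open \<open>S\<close>.\<close>

definition harmonic_fun_on :: "(complex \<Rightarrow> complex) \<Rightarrow> complex set \<Rightarrow> bool" where
  "harmonic_fun_on f S \<longleftrightarrow>
     (\<forall>z\<in>S. f differentiable at z \<and> partial_x f differentiable at z \<and>
             partial_y f differentiable at z) \<and>
     continuous_on S (partial_x (partial_x f)) \<and> continuous_on S (partial_x (partial_y f)) \<and>
     continuous_on S (partial_y (partial_x f)) \<and> continuous_on S (partial_y (partial_y f)) \<and>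
     (\<forall>z\<in>S. partial_x (partial_x f) z + partial_y (partial_y f) z = 0)"

definition class_H :: "(complex \<Rightarrow> complex) set" where
  "class_H = {f. harmonic_fun_on f unit_disc \<and>
     f 0 = 0 \<and> wirtinger_zbar f 0 = 0 \<and> wirtinger_z f 0 - 1 = 0}"

definition class_A :: "(complex \<Rightarrow> complex) set" where
  "class_A = {f \<in> class_H. f holomorphic_on unit_disc}"

text \<open>
  The conditions at \<open>0\<close> say that the Taylor series are
  \<open>h(z) = z + a\<^sub>2 z\<^sup>2 + \<dots>\<close> and \<open>g(z) = b\<^sub>2 z\<^sup>2 + \<dots>\<close>.
\<close>

definition canonical_decomp ::
  "(complex \<Rightarrow> complex) \<Rightarrow> (complex \<Rightarrow> complex) \<Rightarrow> (complex \<Rightarrow> complex) \<Rightarrow> bool" where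
  "canonical_decomp f h g \<longleftrightarrow>
     h holomorphic_on unit_disc \<and> g holomorphic_on unit_disc \<and>
     h 0 = 0 \<and> deriv h 0 = 1 \<and> g 0 = 0 \<and> deriv g 0 = 0 \<and>
     (\<forall>z\<in>unit_disc. f z = h z + cnj (g z))"

text \<open>
  Sense-preserving means positive Jacobian, where the Jacobian of \<open>f\<close> is
  \<open>(norm (wirtinger_z f z))\<^sup>2 - (norm (wirtinger_zbar f z))\<^sup>2\<close>; for \<open>f = h + cnj g\<close> the condition
  in the definition reads \<open>norm (deriv g z) < norm (deriv h z)\<close>.
\<close>

definition class_SH0 :: "(complex \<Rightarrow> complex) set" where
  "class_SH0 = {f \<in> class_H. inj_on f unit_disc \<and>
     (\<forall>z\<in>unit_disc. norm (wirtinger_zbar f z) < norm (wirtinger_z f z))}"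

definition class_W :: "complex \<Rightarrow> (complex \<Rightarrow> complex) \<Rightarrow> (complex \<Rightarrow> complex) set" where
  "class_W \<mu> \<phi> = {f \<in> class_H. \<exists>h g. canonical_decomp f h g \<and>
     (\<forall>z\<in>unit_disc. h z + \<mu> * g z = \<phi> z)}"

definition dilatation :: "(complex \<Rightarrow> complex) \<Rightarrow> (complex \<Rightarrow> complex) \<Rightarrow> complex \<Rightarrow> complex" where
  "dilatation h g z = deriv g z / deriv h z"

definition convex_im_domain :: "complex set \<Rightarrow> bool" where
  "convex_im_domain D \<longleftrightarrow> open D \<and> connected D \<and> D \<noteq> {} \<and>
     (\<forall>x::real. connected (D \<inter> {w. Re w = x}))"

text \<open>This is a condition on the image only; univalence is not part of it.\<close>

definition convex_im :: "(complex \<Rightarrow> complex) \<Rightarrow> bool" where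
  "convex_im f \<longleftrightarrow> convex_im_domain (f ` unit_disc)"

end

theory Submission
  imports Defs
begin

text \<open>
  The map \<open>f = h + cnj g\<close> is a vertical shear of the conformal map \<open>F = h + g\<close>: since
  \<open>f = F - 2\<i> Im g\<close>, the map \<open>f \<circ> F\<inverse>\<close> preserves vertical lines, and along them its imaginary part
  has derivative \<open>Re ((h' - g') / (h' + g'))\<close>, which has the sign of \<open>\<bar>h'\<bar>\<^sup>2 - \<bar>g'\<bar>\<^sup>2\<close>. So a
  sense-preserving \<open>f\<close> is injective on vertical slices and maps them onto connected sets. The
  convex combination \<open>f\<^sub>3\<close> is sense-preserving because the hypothesis on the dilatations is exactly
  nonnegativity of the cross term in \<open>\<bar>h'\<bar>\<^sup>2 - \<bar>g'\<bar>\<^sup>2\<close>.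
\<close>

text \<open>With \<open>w = b / a\<close> the quotient is \<open>(1 - w) / (1 + w)\<close>, which
  maps the unit disc into the right half-plane.\<close>

lemma Re_diff_over_sum_pos:
  fixes a b :: complex
  assumes "norm b < norm a"
  shows "Re ((a - b) / (a + b)) > 0"
proof -
  have "a + b \<noteq> 0"
    using assms by (metis add_eq_0_iff norm_minus_cancel less_irrefl)
  moreover have "Re ((a - b) * cnj (a + b)) = (norm a)\<^sup>2 - (norm b)\<^sup>2"
    unfolding cmod_power2 by (simp add: algebra_simps power2_eq_square)
  moreover have "(norm b)\<^sup>2 < (norm a)\<^sup>2"
    using assms by (simp add: power_strict_mono)
  ultimately show ?thesis
    by (simp add: complex_div_cnj[of "a - b"] Re_divide_of_real del: of_real_power)
qed

text \<open>In the application \<open>G\<close> is \<open>g\<close> composed with the inverse of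
  \<open>F = h + g\<close>, so \<open>Im w - 2 * Im (G w)\<close> is the imaginary part of the
  sheared point. Its derivative in \<open>Im w\<close> along a vertical line is
  \<open>Re (1 - 2 * G' w)\<close>.\<close>

lemma shear_strict_mono_vertical:
  assumes D: "convex_im_domain D" and G: "\<And>w. w \<in> D \<Longrightarrow> (G has_field_derivative G' w) (at w)"
    and pos: "\<And>w. w \<in> D \<Longrightarrow> Re (1 - 2 * G' w) > 0"
    and w: "w\<^sub>1 \<in> D" "w\<^sub>2 \<in> D" "Re w\<^sub>1 = Re w\<^sub>2" "Im w\<^sub>1 < Im w\<^sub>2"
  shows "Im w\<^sub>1 - 2 * Im (G w\<^sub>1) < Im w\<^sub>2 - 2 * Im (G w\<^sub>2)"
proof -
  define x where "x = Re w\<^sub>1"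
  let ?c = "\<lambda>v. of_real x + \<i> * complex_of_real v"
  let ?p = "\<lambda>v. v - 2 * Im (G (?c v))"
  \<comment> \<open>The vertical slice is connected, so its heights fill an interval and the slice
    contains the whole segment from \<open>w\<^sub>1\<close> to \<open>w\<^sub>2\<close>.\<close>
  have "connected (Im ` (D \<inter> {w. Re w = x}))"
    using D by (auto simp: convex_im_domain_def intro!: connected_continuous_image continuous_intros)
  then have "{Im w\<^sub>1..Im w\<^sub>2} \<subseteq> Im ` (D \<inter> {w. Re w = x})"
    using w by (intro connected_contains_Icc) (auto simp: x_def)
  moreover have "?c (Im w) = w" if "Re w = x" for w
    using that by (simp add: complex_eq_iff)
  ultimately have seg: "?c v \<in> D" if "Im w\<^sub>1 \<le> v" "v \<le> Im w\<^sub>2" for v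
    using that by force
  have "?p (Im w\<^sub>1) < ?p (Im w\<^sub>2)"
  proof (rule DERIV_pos_imp_increasing[OF w(4)])
    fix v assume "Im w\<^sub>1 \<le> v" "v \<le> Im w\<^sub>2"
    with seg have cv: "?c v \<in> D" by blast
    \<comment> \<open>The factor \<open>\<i>\<close> from the chain rule turns the imaginary part
      into a real part: \<open>Im (c * \<i>) = Re c\<close>.\<close>
    have "((\<lambda>c. G (of_real x + \<i> * c)) has_field_derivative G' (?c v) * \<i>) (at (of_real v))"
      by (rule DERIV_chain2[where f = G and g = "\<lambda>c. of_real x + \<i> * c", OF G[OF cv]]) (auto intro!: derivative_eq_intros)
    then have "((\<lambda>v. G (?c v)) has_vector_derivative G' (?c v) * \<i>) (at v)"
      by (rule has_vector_derivative_real_field)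
    then have "((\<lambda>v. Im (G (?c v))) has_real_derivative Im (G' (?c v) * \<i>)) (at v)"
      unfolding has_real_derivative_iff_has_vector_derivative
      by (rule bounded_linear.has_vector_derivative[OF bounded_linear_Im])
    from DERIV_diff[OF DERIV_ident DERIV_cmult[OF this, of 2]]
    have "(?p has_real_derivative Re (1 - 2 * G' (?c v))) (at v)"
      by simp
    then show "\<exists>y. (?p has_real_derivative y) (at v) \<and> 0 < y"
      using pos[OF cv] by blast
  qed
  moreover have "?c (Im w\<^sub>1) = w\<^sub>1" "?c (Im w\<^sub>2) = w\<^sub>2"
    using w by (simp_all add: complex_eq_iff x_def)
  ultimately show ?thesis by simp
qed

text \<open>One direction of the Clunie and Sheil-Small shear theorem. Injectivity of
  \<open>h + g\<close> provides the holomorphic inverse through which the shear acts on vertical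
  slices.\<close>

theorem shear_construction:
  assumes h: "h holomorphic_on S" and g: "g holomorphic_on S" and S: "open S"
    and sp: "\<And>z. z \<in> S \<Longrightarrow> norm (deriv g z) < norm (deriv h z)"
    and inj: "inj_on (\<lambda>z. h z + g z) S"
    and D: "convex_im_domain ((\<lambda>z. h z + g z) ` S)"
  shows "inj_on (\<lambda>z. h z + cnj (g z)) S" (is "inj_on ?f S")
    and "convex_im_domain ((\<lambda>z. h z + cnj (g z)) ` S)"
proof -
  let ?F = "\<lambda>z. h z + g z" and ?D = "(\<lambda>z. h z + g z) ` S"
  have F: "?F holomorphic_on S"
    using h g by (intro holomorphic_intros)
  obtain k where k: "k holomorphic_on ?D"
    and k': "\<And>z. z \<in> S \<Longrightarrow> deriv ?F z * deriv k (?F z) = 1"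
    and kF: "\<And>z. z \<in> S \<Longrightarrow> k (?F z) = z"
    using holomorphic_has_inverse[OF F S inj] by metis
  let ?G = "\<lambda>w. g (k w)" and ?G' = "\<lambda>w. deriv g (k w) * deriv k w"
  have oD: "open ?D"
    using D by (simp add: convex_im_domain_def)
  have G: "(?G has_field_derivative ?G' w) (at w)" if "w \<in> ?D" for w
  proof (rule DERIV_chain2[of g _ k])
    show "(k has_field_derivative deriv k w) (at w)"
      using holomorphic_derivI[OF k oD that] .
    show "(g has_field_derivative deriv g (k w)) (at (k w))"
      using that kF by (auto intro!: holomorphic_derivI[OF g S])
  qed
  have pos: "Re (1 - 2 * ?G' w) > 0" if w: "w \<in> ?D" for w
  proof -
    obtain z where z: "z \<in> S" "w = ?F z" using w by blast
    have dF: "deriv ?F z = deriv h z + deriv g z"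
      using h g S z by (intro deriv_add) (auto simp: holomorphic_on_imp_differentiable_at)
    then have "(deriv h z + deriv g z) * deriv k w = 1"
      using k'[OF z(1)] z(2) by simp
    then have "deriv h z + deriv g z \<noteq> 0" and "deriv k w = 1 / (deriv h z + deriv g z)"
      by (auto dest: inverse_unique simp: divide_inverse)
    then have "1 - 2 * ?G' w = (deriv h z - deriv g z) / (deriv h z + deriv g z)"
      using z kF by (simp add: field_simps)
    then show ?thesis
      using Re_diff_over_sum_pos[OF sp[OF z(1)]] by simp
  qed
  \<comment> \<open>This is \<open>cnj c = c - 2 * \<i> * Im c\<close> with \<open>c = g z\<close>;
    the real parts of \<open>?f\<close> and \<open>?F\<close> agree.\<close>
  have Imf: "Im (?f z) = Im (?F z) - 2 * Im (?G (?F z))" if "z \<in> S" for z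
    using kF[OF that] by simp
  have less: "Im (?f z) < Im (?f z')"
    if "z \<in> S" "z' \<in> S" "Re (?F z) = Re (?F z')" "Im (?F z) < Im (?F z')" for z z'
    unfolding Imf[OF that(1)] Imf[OF that(2)]
    using that by (intro shear_strict_mono_vertical[OF D G pos]) auto
  show inj_f: "inj_on ?f S"
  proof (rule inj_onI)
    fix z z' assume z: "z \<in> S" "z' \<in> S" "?f z = ?f z'"
    then have Re: "Re (?F z) = Re (?F z')"
      by (simp add: complex_eq_iff)
    have "Im (?F z) = Im (?F z')"
      using less[OF z(1,2) Re] less[OF z(2,1) Re[symmetric]] z(3) by (metis less_irrefl linorder_neqE)
    with Re have "?F z = ?F z'"
      by (rule complex_eqI)
    then show "z = z'"
      using inj z by (auto dest: inj_onD)
  qed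
  have cont_f: "continuous_on S ?f"
    using h g by (intro continuous_intros holomorphic_on_imp_continuous_on)
  \<comment> \<open>Connectedness of \<open>S\<close> is inherited from \<open>?D\<close> through
    the continuous inverse \<open>k\<close>.\<close>
  have "S = k ` ?D"
    using kF by force
  moreover have k_cont: "continuous_on ?D k"
    using k by (rule holomorphic_on_imp_continuous_on)
  ultimately have "connected S"
    using D by (metis connected_continuous_image convex_im_domain_def)
  moreover have "connected (?f ` S \<inter> {w. Re w = x})" for x
  proof -
    \<comment> \<open>Since \<open>Re (?f z) = Re (?F z)\<close>, the slice of the image of
      \<open>?f\<close> over \<open>x\<close> is the image of \<open>?L\<close> under
      \<open>?f\<close> after \<open>k\<close>.\<close>
    let ?L = "?D \<inter> {w. Re w = x}"
    have "?f ` S \<inter> {w. Re w = x} = ?f ` k ` ?L"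
      using kF by (force simp: image_iff)
    moreover have "connected (k ` ?L)"
      using D continuous_on_subset[OF k_cont]
      by (intro connected_continuous_image) (auto simp: convex_im_domain_def)
    moreover have "k ` ?L \<subseteq> S"
      using kF by auto
    ultimately show ?thesis
      using connected_continuous_image[OF continuous_on_subset[OF cont_f]] by simp
  qed
  \<comment> \<open>\<open>?f\<close> need not be holomorphic, so openness comes from continuity and
    injectivity.\<close>
  moreover have "open (?f ` S)"
    using cont_f S inj_f by (intro invariance_of_domain) auto
  ultimately show "convex_im_domain (?f ` S)"
    using D cont_f by (auto simp: convex_im_domain_def intro!: connected_continuous_image)
qed

text \<open>The real derivative of \<open>f\<close> is \<open>v\<close> mapped to
  \<open>h' v + cnj (g' v)\<close>, whose complex-linear and antilinear parts are the two Wirtinger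
  derivatives. This turns the condition in \<open>class_SH0\<close> into
  \<open>norm (deriv g z) < norm (deriv h z)\<close>.\<close>

lemma canonical_decomp_wirtinger:
  assumes "canonical_decomp f h g" and z: "z \<in> unit_disc"
  shows "wirtinger_z f z = deriv h z" and "wirtinger_zbar f z = cnj (deriv g z)"
proof -
  have h: "h holomorphic_on unit_disc" and g: "g holomorphic_on unit_disc"
    and f: "\<And>z. z \<in> unit_disc \<Longrightarrow> f z = h z + cnj (g z)"
    using assms by (auto simp: canonical_decomp_def)
  have "((\<lambda>z. h z + cnj (g z)) has_derivative (\<lambda>v. deriv h z * v + cnj (deriv g z * v))) (at z)"
    using holomorphic_derivI[OF h open_ball z] holomorphic_derivI[OF g open_ball z]
    unfolding has_field_derivative_def
    by (intro has_derivative_add bounded_linear.has_derivative[OF bounded_linear_cnj])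
  then have "(f has_derivative (\<lambda>v. deriv h z * v + cnj (deriv g z * v))) (at z)"
    by (rule has_derivative_transform_within_open[OF _ open_ball z]) (simp add: f)
  then have "frechet_derivative f (at z) = (\<lambda>v. deriv h z * v + cnj (deriv g z * v))"
    by (rule frechet_derivative_at[symmetric])
  then show "wirtinger_z f z = deriv h z" and "wirtinger_zbar f z = cnj (deriv g z)"
    by (simp_all add: wirtinger_z_def wirtinger_zbar_def partial_x_def partial_y_def algebra_simps)
qed

lemma holomorphic_eq_if_deriv_eq:
  assumes "u holomorphic_on unit_disc" "v holomorphic_on unit_disc" "u 0 = v 0"
    and "\<And>z. z \<in> unit_disc \<Longrightarrow> deriv u z = deriv v z" and z: "z \<in> unit_disc"
  shows "u z = v z"
proof -
  have "((\<lambda>z. u z - v z) has_field_derivative 0) (at z)" if "z \<in> unit_disc" for z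
    using DERIV_diff[OF holomorphic_derivI[OF assms(1) open_ball that]
        holomorphic_derivI[OF assms(2) open_ball that]] assms(4)[OF that] by simp
  then obtain c where "\<And>z. z \<in> unit_disc \<Longrightarrow> u z - v z = c"
    using has_field_derivative_zero_constant[of unit_disc "\<lambda>z. u z - v z"]
    by (metis convex_ball has_field_derivative_at_within)
  from this[of 0] this[OF z] assms(3) show ?thesis by simp
qed

text \<open>The Wirtinger derivatives of \<open>f\<close> determine the derivatives of both parts,
  and the values at \<open>0\<close> fix the constants.\<close>

lemma canonical_decomp_unique:
  assumes d: "canonical_decomp f h g" and d': "canonical_decomp f h' g'" and z: "z \<in> unit_disc"
  shows "h z = h' z" and "g z = g' z"
proof -
  have deriv_eq: "deriv h w = deriv h' w" "deriv g w = deriv g' w" if "w \<in> unit_disc" for w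
    using canonical_decomp_wirtinger[OF d that] canonical_decomp_wirtinger[OF d' that] by auto
  show "h z = h' z"
    by (rule holomorphic_eq_if_deriv_eq[OF _ _ _ deriv_eq(1) z])
      (use d d' in \<open>simp_all add: canonical_decomp_def\<close>)
  show "g z = g' z"
    by (rule holomorphic_eq_if_deriv_eq[OF _ _ _ deriv_eq(2) z])
      (use d d' in \<open>simp_all add: canonical_decomp_def\<close>)
qed

text \<open>\<open>class_W\<close> only provides some decomposition; uniqueness carries its equation
  over to the given \<open>h\<close> and \<open>g\<close>.\<close>

lemma class_W_decomp:
  assumes "f \<in> class_W \<mu> \<phi>" and "canonical_decomp f h g" and "z \<in> unit_disc"
  shows "h z + \<mu> * g z = \<phi> z"
proof -
  obtain h' g' where d': "canonical_decomp f h' g'" and "h' z + \<mu> * g' z = \<phi> z"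
    using assms(1,3) unfolding class_W_def by blast
  then show ?thesis
    using canonical_decomp_unique[OF assms(2) d' assms(3)] by simp
qed

lemma sense_preserving_convex_combination:
  fixes a\<^sub>1 a\<^sub>2 b\<^sub>1 b\<^sub>2 :: complex and t :: real
  assumes "0 \<le> t" "t \<le> 1" "norm b\<^sub>1 < norm a\<^sub>1" "norm b\<^sub>2 < norm a\<^sub>2"
    and cross: "Re (a\<^sub>1 * cnj a\<^sub>2 - b\<^sub>1 * cnj b\<^sub>2) \<ge> 0"
  shows "norm (of_real t * b\<^sub>1 + of_real (1 - t) * b\<^sub>2) < norm (of_real t * a\<^sub>1 + of_real (1 - t) * a\<^sub>2)"
proof -
  have sq: "(norm (of_real t * x + of_real (1 - t) * y))\<^sup>2
      = t\<^sup>2 * (norm x)\<^sup>2 + (1 - t)\<^sup>2 * (norm y)\<^sup>2 + 2 * (t * (1 - t)) * Re (x * cnj y)"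
    for x y :: complex
    unfolding cmod_power2 by (simp add: algebra_simps power2_eq_square)
  define A where "A = (norm a\<^sub>1)\<^sup>2 - (norm b\<^sub>1)\<^sup>2"
  define B where "B = (norm a\<^sub>2)\<^sup>2 - (norm b\<^sub>2)\<^sup>2"
  have "A > 0" "B > 0"
    using assms by (simp_all add: A_def B_def power_strict_mono)
  \<comment> \<open>For \<open>t = 0\<close> only \<open>B\<close> remains; otherwise the first
    summand is already positive.\<close>
  then have "t\<^sup>2 * A + (1 - t)\<^sup>2 * B > 0"
    by (cases "t = 0") (auto intro!: add_pos_nonneg)
  moreover have "2 * (t * (1 - t)) * Re (a\<^sub>1 * cnj a\<^sub>2 - b\<^sub>1 * cnj b\<^sub>2) \<ge> 0"
    using assms by (intro mult_nonneg_nonneg) auto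
  ultimately have "(norm (of_real t * b\<^sub>1 + of_real (1 - t) * b\<^sub>2))\<^sup>2
      < (norm (of_real t * a\<^sub>1 + of_real (1 - t) * a\<^sub>2))\<^sup>2"
    unfolding sq A_def B_def by (simp add: right_diff_distrib)
  then show ?thesis
    by (rule power2_less_imp_less) simp
qed

text \<open>Univalence of the combination of \<open>\<phi>\<close> and \<open>\<psi>\<close> is a
  separate assumption, as \<open>convex_im\<close> concerns the image only and the shear starts from
  an injective map.\<close>

theorem theorem4:
  fixes \<phi> \<psi> f\<^sub>1 f\<^sub>2 h\<^sub>1 g\<^sub>1 h\<^sub>2 g\<^sub>2 :: "complex \<Rightarrow> complex" and t :: real
  assumes "\<phi> \<in> class_A" and "\<psi> \<in> class_A"
    and "0 \<le> t" and "t \<le> 1"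
    and "canonical_decomp f\<^sub>1 h\<^sub>1 g\<^sub>1" and "f\<^sub>1 \<in> class_SH0"
    and "canonical_decomp f\<^sub>2 h\<^sub>2 g\<^sub>2" and "f\<^sub>2 \<in> class_SH0"
    and "f\<^sub>1 \<in> class_W 1 \<phi>" and "f\<^sub>2 \<in> class_W 1 \<psi>"
    and "\<forall>z\<in>unit_disc.
           Re ((1 - dilatation h\<^sub>1 g\<^sub>1 z * cnj (dilatation h\<^sub>2 g\<^sub>2 z)) *
               deriv h\<^sub>1 z * cnj (deriv h\<^sub>2 z)) \<ge> 0"
    and "inj_on (\<lambda>z. of_real t * \<phi> z + of_real (1 - t) * \<psi> z) unit_disc"
    and "convex_im (\<lambda>z. of_real t * \<phi> z + of_real (1 - t) * \<psi> z)"
  shows "inj_on (\<lambda>z. of_real t * f\<^sub>1 z + of_real (1 - t) * f\<^sub>2 z) unit_disc \<and>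
         convex_im (\<lambda>z. of_real t * f\<^sub>1 z + of_real (1 - t) * f\<^sub>2 z)"
proof -
  let ?comb = "\<lambda>u v z. of_real t * u z + of_real (1 - t) * v z :: complex"
  let ?h = "?comb h\<^sub>1 h\<^sub>2" and ?g = "?comb g\<^sub>1 g\<^sub>2"
  note d\<^sub>1 = assms(5) and d\<^sub>2 = assms(7)
  have hol: "h\<^sub>1 holomorphic_on unit_disc" "h\<^sub>2 holomorphic_on unit_disc"
    "g\<^sub>1 holomorphic_on unit_disc" "g\<^sub>2 holomorphic_on unit_disc"
    using d\<^sub>1 d\<^sub>2 by (auto simp: canonical_decomp_def)
  have comb_hol: "?h holomorphic_on unit_disc" "?g holomorphic_on unit_disc"
    using hol by (auto intro!: holomorphic_intros)
  have deriv_comb: "deriv (?comb u v) z = of_real t * deriv u z + of_real (1 - t) * deriv v z"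
    if "u holomorphic_on unit_disc" "v holomorphic_on unit_disc" "z \<in> unit_disc" for u v z
    using holomorphic_derivI[OF that(1) open_ball that(3)] holomorphic_derivI[OF that(2) open_ball that(3)]
    by (intro DERIV_imp_deriv DERIV_add DERIV_cmult)
  have sp: "norm (deriv ?g z) < norm (deriv ?h z)" if z: "z \<in> unit_disc" for z
  proof -
    have lt: "norm (deriv g\<^sub>1 z) < norm (deriv h\<^sub>1 z)" "norm (deriv g\<^sub>2 z) < norm (deriv h\<^sub>2 z)"
      using assms(6,8) z canonical_decomp_wirtinger[OF d\<^sub>1 z] canonical_decomp_wirtinger[OF d\<^sub>2 z]
      unfolding class_SH0_def by (metis (mono_tags, lifting) complex_mod_cnj mem_Collect_eq)+
    then have "deriv h\<^sub>1 z \<noteq> 0" "deriv h\<^sub>2 z \<noteq> 0"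
      by auto
    \<comment> \<open>Clearing the nonzero denominators turns the dilatation condition into the
      cross term of the squared norms.\<close>
    then have "(1 - dilatation h\<^sub>1 g\<^sub>1 z * cnj (dilatation h\<^sub>2 g\<^sub>2 z)) * deriv h\<^sub>1 z * cnj (deriv h\<^sub>2 z)
        = deriv h\<^sub>1 z * cnj (deriv h\<^sub>2 z) - deriv g\<^sub>1 z * cnj (deriv g\<^sub>2 z)"
      by (simp add: dilatation_def field_simps)
    then have "Re (deriv h\<^sub>1 z * cnj (deriv h\<^sub>2 z) - deriv g\<^sub>1 z * cnj (deriv g\<^sub>2 z)) \<ge> 0"
      using assms(11) z by metis
    then show ?thesis
      unfolding deriv_comb[OF hol(1,2) z] deriv_comb[OF hol(3,4) z]
      using assms(3,4) lt by (intro sense_preserving_convex_combination)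
  qed
  have F: "?comb \<phi> \<psi> z = ?h z + ?g z" if "z \<in> unit_disc" for z
    using class_W_decomp[OF assms(9) d\<^sub>1 that, symmetric] class_W_decomp[OF assms(10) d\<^sub>2 that, symmetric]
    by (simp add: algebra_simps)
  have f: "?comb f\<^sub>1 f\<^sub>2 z = ?h z + cnj (?g z)" if "z \<in> unit_disc" for z
    using d\<^sub>1 d\<^sub>2 that by (simp add: canonical_decomp_def algebra_simps)
  have "inj_on (\<lambda>z. ?h z + ?g z) unit_disc"
    using assms(12) inj_on_cong[of unit_disc, OF F] by simp
  moreover have "convex_im_domain ((\<lambda>z. ?h z + ?g z) ` unit_disc)"
    using assms(13) image_cong[of unit_disc, OF refl F] by (simp add: convex_im_def)
  ultimately have "inj_on (\<lambda>z. ?h z + cnj (?g z)) unit_disc"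
    "convex_im_domain ((\<lambda>z. ?h z + cnj (?g z)) ` unit_disc)"
    using shear_construction[OF comb_hol open_ball sp] by blast+
  then show ?thesis
    using inj_on_cong[of unit_disc, OF f] image_cong[of unit_disc, OF refl f]
    by (simp add: convex_im_def)
qed

end
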